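(* Let $(R,\cdot,(P_\omega)_{\omega\in S},\theta)$ be a Rota-Baxter family Hom-associative algebra of weight $\lambda$, $E$ a vector space containing $R$ as a subspace, $\rho:E\to R$ a linear retraction (a linear map with $\rho(a)=a$ for all $a\in R$), and $V=\ker\rho$. Let $\Upsilon_1:\mathbf{Exts}(E,R)\to\mathcal{O}(R,V)$ be the map that sends an extension $(E,\cdot_E,(P_{\omega,E}),\theta_E)$ to the extending structure $\Omega(R,V)$ obtained from it via $\rho$. Then: (1) $\Upsilon_1$ induces a bijection of equivalence classes with respect to $\equiv$: $\Upsilon:\mathbf{Extd}(E,R)=\mathbf{Exts}(E,R)/\!\equiv\ \to\ H^2(V,R)=\mathcal{O}(R,V)/\!\equiv$, $[(E,\cdot_E,(P_{\omega,E}),\theta_E)]\mapsto[\Omega(R,V)]$. (2) $\Upsilon_1$ induces a bijection of equivalence classes with respect to $\approx$: $\Upsilon':\mathbf{Extd}'(E,R)=\mathbf{Exts}(E,R)/\!\approx\ \to\ H^2_V(V,R)=\mathcal{O}(R,V)/\!\approx$, $\overline{(E,\cdot_E,(P_{\omega,E}),\theta_E)}\mapsto\overline{\Omega(R,V)}$.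
   Context: Fix a field $\mathbf{k}$, a semigroup $S$ and $\lambda\in\mathbf{k}$. All vector spaces and (bi)linear maps are over $\mathbf{k}$; families are indexed by $\omega\in S$. A Rota-Baxter family Hom-associative algebra (of weight $\lambda$) is a 4-tuple $(R,\cdot,(P_\omega)_{\omega\in S},\theta)$, with $R$ a vector space, $\cdot:R\times R\to R$ bilinear, $P_\omega:R\to R$ ($\omega\in S$) and $\theta:R\to R$ linear, such that for all $x,y,z\in R$ and $\omega,\alpha,\beta\in S$: $\theta(x)\cdot(y\cdot z)=(x\cdot y)\cdot\theta(z)$; $P_\alpha(x)\cdot P_\beta(y)=P_{\alpha\beta}(P_\alpha(x)\cdot y+x\cdot P_\beta(y)+\lambda\,x\cdot y)$; $P_\omega(\theta(x))=\theta(P_\omega(x))$. Morphisms are linear maps commuting with the products, with $P_\omega$ for each $\omega\in S$, and with $\theta$; isomorphisms are bijective morphisms. $\mathbf{Exts}(E,R)$ is the set of extensions of $R$ on $E$: all Rota-Baxter family Hom-associative algebra structures $(E,\cdot_E,(P_{\omega,E}),\theta_E)$ of weight $\lambda$ on the vector space $E$ containing $R$ as a subalgebra, i.e. such that $\cdot_E,P_{\omega,E},\theta_E$ restrict on $R$ to $\cdot,P_\omega,\theta$. Two elements of $\mathbf{Exts}(E,R)$ are equivalent ($\equiv$) if there is an isomorphism $\psi$ of Rota-Baxter family Hom-associative algebras from the first to the second that stabilizes $R$: $\psi(a)=a$ for all $a\in R$. They are cohomologous ($\approx$) if moreover $\psi$ can be chosen to co-stabilize $V$: $\pi\circ\psi=\pi$,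 where $\pi:E\to V$, $\pi(a+x)=x$ for $a\in R,x\in V$. Both are equivalence relations. Extending datum of $R$ through a vector space $V$: a system $\Omega(R,V)=(\triangleright,\triangleleft,\rightharpoonup,\leftharpoonup,f,\cdot_V,(Q_\omega),(P_{\omega,V}),\eta,\theta_V)$ of bilinear maps $\triangleright:R\times V\to V$, $\triangleleft:V\times R\to V$, $\rightharpoonup:V\times R\to R$, $\leftharpoonup:R\times V\to R$, $f:V\times V\to R$, $\cdot_V:V\times V\to V$ and linear maps $Q_\omega:V\to R$, $P_{\omega,V}:V\to V$, $\eta:V\to R$, $\theta_V:V\to V$. On $R\times V$ define $(a,x)\,\bar\cdot\,(b,y)=(ab+a\leftharpoonup y+x\rightharpoonup b+f(x,y),\ a\triangleright y+x\triangleleft b+x\cdot_V y)$, $\bar P_\omega(a,x)=(P_\omega(a)+Q_\omega(x),P_{\omega,V}(x))$, $\bar\theta(a,x)=(\theta(a)+\eta(x),\theta_V(x))$. The datum is a Rota-Baxter family Hom extending structure of $R$ through $V$ if $(R\times V,\bar\cdot,(\bar P_\omega),\bar\theta)$ is a Rota-Baxter family Hom-associative algebra of weight $\lambda$. $\mathcal{O}(R,V)$ is the set of all such structures. Two elements $\Omega(R,V)$ and $\Omega'(R,V)=(\triangleright',\triangleleft',\rightharpoonup',\leftharpoonup',f',\cdot'_V,(Q'_\omega),(P'_{\omega,V}),\eta',\theta'_V)$ of $\mathcal{O}(R,V)$ are equivalent ($\equiv$) if there are linear maps $g:V\to R$ and $h\in\mathrm{Aut}_{\mathbf{k}}(V)$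 such that for all $a\in R$, $x,y\in V$, $\omega\in S$: $h(a\triangleright x)=a\triangleright'h(x)$, $h(x\triangleleft a)=h(x)\triangleleft'a$, $h(P_{\omega,V}(x))=P'_{\omega,V}(h(x))$, $h(\theta_V(x))=\theta'_V(h(x))$; $a\leftharpoonup x+g(a\triangleright x)=a\,g(x)+a\leftharpoonup'h(x)$; $x\rightharpoonup a+g(x\triangleleft a)=g(x)a+h(x)\rightharpoonup'a$; $f(x,y)+g(x\cdot_V y)=g(x)g(y)+g(x)\leftharpoonup'h(y)+h(x)\rightharpoonup'g(y)+f'(h(x),h(y))$; $h(x\cdot_V y)=g(x)\triangleright'h(y)+h(x)\triangleleft'g(y)+h(x)\cdot'_V h(y)$; $Q_\omega(x)+g(P_{\omega,V}(x))=P_\omega(g(x))+Q'_\omega(h(x))$; $\eta(x)+g(\theta_V(x))=\theta(g(x))+\eta'(h(x))$. They are cohomologous ($\approx$) if this holds for some $g$ with $h=\mathrm{Id}_V$. Both are equivalence relations. The map $\Upsilon_1$ sends $(E,\cdot_E,(P_{\omega,E}),\theta_E)$ to the element of $\mathcal{O}(R,V)$ given, for $a\in R$, $x,y\in V$, by $a\triangleright x=a\cdot_E x-\rho(a\cdot_E x)$, $x\triangleleft a=x\cdot_E a-\rho(x\cdot_E a)$, $a\leftharpoonup x=\rho(a\cdot_E x)$, $x\rightharpoonup a=\rho(x\cdot_E a)$, $f(x,y)=\rho(x\cdot_E y)$, $x\cdot_V y=x\cdot_E y-\rho(x\cdot_E y)$, $Q_\omega(x)=\rho(P_{\omega,E}(x))$,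 $P_{\omega,V}(x)=P_{\omega,E}(x)-\rho(P_{\omega,E}(x))$, $\eta(x)=\rho(\theta_E(x))$, $\theta_V(x)=\theta_E(x)-\rho(\theta_E(x))$. *)

theory Defs
  imports "HOL-Analysis.Product_Vector" "HOL-Library.FuncSet"
begin

section \<open>Linear maps between subspaces\<close>

definition linear_on ::
  "('k \<Rightarrow> 'a \<Rightarrow> 'a) \<Rightarrow> ('k \<Rightarrow> 'b \<Rightarrow> 'b) \<Rightarrow> 'a::plus set \<Rightarrow> 'b::plus set \<Rightarrow> ('a \<Rightarrow> 'b) \<Rightarrow> bool"
  where "linear_on s1 s2 A B f \<longleftrightarrow>
    f \<in> A \<rightarrow> B \<and>
    (\<forall>x\<in>A. \<forall>y\<in>A. f (x + y) = f x + f y) \<and>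
    (\<forall>c. \<forall>x\<in>A. f (s1 c x) = s2 c (f x))"

definition bilinear_on ::
  "('k \<Rightarrow> 'a \<Rightarrow> 'a) \<Rightarrow> ('k \<Rightarrow> 'b \<Rightarrow> 'b) \<Rightarrow> ('k \<Rightarrow> 'c \<Rightarrow> 'c) \<Rightarrow>
   'a::plus set \<Rightarrow> 'b::plus set \<Rightarrow> 'c::plus set \<Rightarrow> ('a \<Rightarrow> 'b \<Rightarrow> 'c) \<Rightarrow> bool"
  where "bilinear_on s1 s2 s3 A B C f \<longleftrightarrow>
    (\<forall>x\<in>A. linear_on s2 s3 B C (\<lambda>y. f x y)) \<and>
    (\<forall>y\<in>B. linear_on s1 s3 A C (\<lambda>x. f x y))"


section \<open>Rota-Baxter family Hom-associative algebras\<close>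

record ('s, 'a) rbf_ops =
  mul :: "'a \<Rightarrow> 'a \<Rightarrow> 'a"
  rb :: "'s \<Rightarrow> 'a \<Rightarrow> 'a"
  twist :: "'a \<Rightarrow> 'a"

text \<open>The underlying vector space is a subspace \<open>A\<close> of the ambient space given by the type and
  the scalar multiplication \<open>s\<close>. The operations matter only on \<open>A\<close>.\<close>

definition rbf_hom_algebra ::
  "('k::field \<Rightarrow> 'a \<Rightarrow> 'a) \<Rightarrow> 'k \<Rightarrow> 'a::ab_group_add set \<Rightarrow> ('s::semigroup_mult, 'a) rbf_ops \<Rightarrow> bool"
  where "rbf_hom_algebra s lam A X \<longleftrightarrow>
    vector_space s \<and> module.subspace s A \<and>
    bilinear_on s s s A A A (mul X) \<and>
    (\<forall>\<omega>. linear_on s s A A (rb X \<omega>)) \<and>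
    linear_on s s A A (twist X) \<and>
    (\<forall>x\<in>A. \<forall>y\<in>A. \<forall>z\<in>A.
      mul X (twist X x) (mul X y z) = mul X (mul X x y) (twist X z)) \<and>
    (\<forall>\<alpha> \<beta>. \<forall>x\<in>A. \<forall>y\<in>A.
      mul X (rb X \<alpha> x) (rb X \<beta> y) =
      rb X (\<alpha> * \<beta>) (mul X (rb X \<alpha> x) y + mul X x (rb X \<beta> y) + s lam (mul X x y))) \<and>
    (\<forall>\<omega>. \<forall>x\<in>A. rb X \<omega> (twist X x) = twist X (rb X \<omega> x))"

definition rbf_hom_morphism ::
  "('k \<Rightarrow> 'a \<Rightarrow> 'a) \<Rightarrow> ('k \<Rightarrow> 'b \<Rightarrow> 'b) \<Rightarrow> 'a::plus set \<Rightarrow> 'b::plus set \<Rightarrow>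
   ('s, 'a) rbf_ops \<Rightarrow> ('s, 'b) rbf_ops \<Rightarrow> ('a \<Rightarrow> 'b) \<Rightarrow> bool"
  where "rbf_hom_morphism s1 s2 A B X Y \<psi> \<longleftrightarrow>
    linear_on s1 s2 A B \<psi> \<and>
    (\<forall>x\<in>A. \<forall>y\<in>A. \<psi> (mul X x y) = mul Y (\<psi> x) (\<psi> y)) \<and>
    (\<forall>\<omega>. \<forall>x\<in>A. \<psi> (rb X \<omega> x) = rb Y \<omega> (\<psi> x)) \<and>
    (\<forall>x\<in>A. \<psi> (twist X x) = twist Y (\<psi> x))"

definition rbf_hom_iso ::
  "('k \<Rightarrow> 'a \<Rightarrow> 'a) \<Rightarrow> ('k \<Rightarrow> 'b \<Rightarrow> 'b) \<Rightarrow> 'a::plus set \<Rightarrow> 'b::plus set \<Rightarrow>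
   ('s, 'a) rbf_ops \<Rightarrow> ('s, 'b) rbf_ops \<Rightarrow> ('a \<Rightarrow> 'b) \<Rightarrow> bool"
  where "rbf_hom_iso s1 s2 A B X Y \<psi> \<longleftrightarrow>
    rbf_hom_morphism s1 s2 A B X Y \<psi> \<and> bij_betw \<psi> A B"


section \<open>Extensions of \<open>R\<close> on \<open>E\<close>\<close>

text \<open>Here \<open>E\<close> is the whole type, and \<open>X\<close> is the given structure on the subspace \<open>R\<close>.\<close>

definition Exts ::
  "('k::field \<Rightarrow> 'e \<Rightarrow> 'e) \<Rightarrow> 'k \<Rightarrow> 'e::ab_group_add set \<Rightarrow> ('s::semigroup_mult, 'e) rbf_ops \<Rightarrow>
   ('s, 'e) rbf_ops set"
  where "Exts s lam R X = {Y. rbf_hom_algebra s lam UNIV Y \<and>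
    (\<forall>a\<in>R. \<forall>b\<in>R. mul Y a b = mul X a b) \<and>
    (\<forall>\<omega>. \<forall>a\<in>R. rb Y \<omega> a = rb X \<omega> a) \<and>
    (\<forall>a\<in>R. twist Y a = twist X a)}"

definition Exts_equiv ::
  "('k::field \<Rightarrow> 'e \<Rightarrow> 'e) \<Rightarrow> 'k \<Rightarrow> 'e::ab_group_add set \<Rightarrow> ('s::semigroup_mult, 'e) rbf_ops \<Rightarrow>
   ('s, 'e) rbf_ops rel"
  where "Exts_equiv s lam R X = {(Y, Z). Y \<in> Exts s lam R X \<and> Z \<in> Exts s lam R X \<and>
    (\<exists>\<psi>. rbf_hom_iso s s UNIV UNIV Y Z \<psi> \<and> (\<forall>a\<in>R. \<psi> a = a))}"

text \<open>The projection of \<open>E\<close> onto \<open>ker \<rho>\<close> along \<open>R\<close>.\<close>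

definition ker_proj :: "('e \<Rightarrow> 'e) \<Rightarrow> 'e::ab_group_add \<Rightarrow> 'e"
  where "ker_proj \<rho> e = e - \<rho> e"

lemma ker_proj_add:
  assumes "Vector_Spaces.linear s s \<rho>" "\<And>a. a \<in> R \<Longrightarrow> \<rho> a = a" "a \<in> R" "\<rho> x = 0"
  shows "ker_proj \<rho> (a + x) = x"
proof -
  interpret Vector_Spaces.linear s s \<rho> by fact
  show ?thesis using assms by (simp add: ker_proj_def add)
qed

definition Exts_cohom ::
  "('k::field \<Rightarrow> 'e \<Rightarrow> 'e) \<Rightarrow> 'k \<Rightarrow> 'e::ab_group_add set \<Rightarrow> ('s::semigroup_mult, 'e) rbf_ops \<Rightarrow>
   ('e \<Rightarrow> 'e) \<Rightarrow> ('s, 'e) rbf_ops rel"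
  where "Exts_cohom s lam R X \<rho> = {(Y, Z). Y \<in> Exts s lam R X \<and> Z \<in> Exts s lam R X \<and>
    (\<exists>\<psi>. rbf_hom_iso s s UNIV UNIV Y Z \<psi> \<and> (\<forall>a\<in>R. \<psi> a = a) \<and>
      ker_proj \<rho> \<circ> \<psi> = ker_proj \<rho>)}"


section \<open>Extending structures of \<open>R\<close> through \<open>V\<close>\<close>

text \<open>The first four fields are, in this order, the maps \<open>\<triangleright>\<close>, \<open>\<triangleleft>\<close>, \<open>\<rightharpoonup>\<close>, \<open>\<leftharpoonup>\<close>.\<close>

record ('s, 'a, 'b) ext_datum =
  rtri :: "'a \<Rightarrow> 'b \<Rightarrow> 'b"
  ltri :: "'b \<Rightarrow> 'a \<Rightarrow> 'b"
  rharp :: "'b \<Rightarrow> 'a \<Rightarrow> 'a"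
  lharp :: "'a \<Rightarrow> 'b \<Rightarrow> 'a"
  cocyc :: "'b \<Rightarrow> 'b \<Rightarrow> 'a"
  mulV :: "'b \<Rightarrow> 'b \<Rightarrow> 'b"
  Qmap :: "'s \<Rightarrow> 'b \<Rightarrow> 'a"
  rbV :: "'s \<Rightarrow> 'b \<Rightarrow> 'b"
  eta :: "'b \<Rightarrow> 'a"
  twistV :: "'b \<Rightarrow> 'b"

text \<open>The extensional function spaces fix the values outside \<open>R\<close> and \<open>V\<close>, so that equality of
  data is equality of maps on \<open>R\<close> and \<open>V\<close>.\<close>

definition extending_datum ::
  "('k \<Rightarrow> 'a \<Rightarrow> 'a) \<Rightarrow> ('k \<Rightarrow> 'b \<Rightarrow> 'b) \<Rightarrow> 'a::plus set \<Rightarrow> 'b::plus set \<Rightarrow>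
   ('s, 'a, 'b) ext_datum \<Rightarrow> bool"
  where "extending_datum sR sV R V D \<longleftrightarrow>
    rtri D \<in> R \<rightarrow>\<^sub>E V \<rightarrow>\<^sub>E V \<and> bilinear_on sR sV sV R V V (rtri D) \<and>
    ltri D \<in> V \<rightarrow>\<^sub>E R \<rightarrow>\<^sub>E V \<and> bilinear_on sV sR sV V R V (ltri D) \<and>
    rharp D \<in> V \<rightarrow>\<^sub>E R \<rightarrow>\<^sub>E R \<and> bilinear_on sV sR sR V R R (rharp D) \<and>
    lharp D \<in> R \<rightarrow>\<^sub>E V \<rightarrow>\<^sub>E R \<and> bilinear_on sR sV sR R V R (lharp D) \<and>
    cocyc D \<in> V \<rightarrow>\<^sub>E V \<rightarrow>\<^sub>E R \<and> bilinear_on sV sV sR V V R (cocyc D) \<and>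
    mulV D \<in> V \<rightarrow>\<^sub>E V \<rightarrow>\<^sub>E V \<and> bilinear_on sV sV sV V V V (mulV D) \<and>
    (\<forall>\<omega>. Qmap D \<omega> \<in> V \<rightarrow>\<^sub>E R \<and> linear_on sV sR V R (Qmap D \<omega>)) \<and>
    (\<forall>\<omega>. rbV D \<omega> \<in> V \<rightarrow>\<^sub>E V \<and> linear_on sV sV V V (rbV D \<omega>)) \<and>
    eta D \<in> V \<rightarrow>\<^sub>E R \<and> linear_on sV sR V R (eta D) \<and>
    twistV D \<in> V \<rightarrow>\<^sub>E V \<and> linear_on sV sV V V (twistV D)"

definition unified_product ::
  "('s, 'a) rbf_ops \<Rightarrow> ('s, 'a, 'b) ext_datum \<Rightarrow> ('s, 'a::plus \<times> 'b::plus) rbf_ops"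
  where "unified_product X D = \<lparr>
    mul = (\<lambda>(a, x) (b, y).
      (mul X a b + lharp D a y + rharp D x b + cocyc D x y,
       rtri D a y + ltri D x b + mulV D x y)),
    rb = (\<lambda>\<omega> (a, x). (rb X \<omega> a + Qmap D \<omega> x, rbV D \<omega> x)),
    twist = (\<lambda>(a, x). (twist X a + eta D x, twistV D x))\<rparr>"

definition Ext_structs ::
  "('k::field \<Rightarrow> 'a \<Rightarrow> 'a) \<Rightarrow> ('k \<Rightarrow> 'b \<Rightarrow> 'b) \<Rightarrow> 'k \<Rightarrow> 'a::ab_group_add set \<Rightarrow> 'b::ab_group_add set \<Rightarrow>
   ('s::semigroup_mult, 'a) rbf_ops \<Rightarrow> ('s, 'a, 'b) ext_datum set"
  where "Ext_structs sR sV lam R V X = {D. extending_datum sR sV R V D \<and>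
    rbf_hom_algebra (module_prod.scale sR sV) lam (R \<times> V) (unified_product X D)}"

definition datum_compat ::
  "'a::plus set \<Rightarrow> 'b::plus set \<Rightarrow> ('s, 'a) rbf_ops \<Rightarrow>
   ('s, 'a, 'b) ext_datum \<Rightarrow> ('s, 'a, 'b) ext_datum \<Rightarrow> ('b \<Rightarrow> 'a) \<Rightarrow> ('b \<Rightarrow> 'b) \<Rightarrow> bool"
  where "datum_compat R V X D D' g h \<longleftrightarrow>
    (\<forall>a\<in>R. \<forall>x\<in>V. h (rtri D a x) = rtri D' a (h x)) \<and>
    (\<forall>a\<in>R. \<forall>x\<in>V. h (ltri D x a) = ltri D' (h x) a) \<and>
    (\<forall>\<omega>. \<forall>x\<in>V. h (rbV D \<omega> x) = rbV D' \<omega> (h x)) \<and>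
    (\<forall>x\<in>V. h (twistV D x) = twistV D' (h x)) \<and>
    (\<forall>a\<in>R. \<forall>x\<in>V. lharp D a x + g (rtri D a x) = mul X a (g x) + lharp D' a (h x)) \<and>
    (\<forall>a\<in>R. \<forall>x\<in>V. rharp D x a + g (ltri D x a) = mul X (g x) a + rharp D' (h x) a) \<and>
    (\<forall>x\<in>V. \<forall>y\<in>V. cocyc D x y + g (mulV D x y) =
      mul X (g x) (g y) + lharp D' (g x) (h y) + rharp D' (h x) (g y) + cocyc D' (h x) (h y)) \<and>
    (\<forall>x\<in>V. \<forall>y\<in>V. h (mulV D x y) =
      rtri D' (g x) (h y) + ltri D' (h x) (g y) + mulV D' (h x) (h y)) \<and>
    (\<forall>\<omega>. \<forall>x\<in>V. Qmap D \<omega> x + g (rbV D \<omega> x) = rb X \<omega> (g x) + Qmap D' \<omega> (h x)) \<and>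
    (\<forall>x\<in>V. eta D x + g (twistV D x) = twist X (g x) + eta D' (h x))"

definition datum_equiv ::
  "('k::field \<Rightarrow> 'a \<Rightarrow> 'a) \<Rightarrow> ('k \<Rightarrow> 'b \<Rightarrow> 'b) \<Rightarrow> 'k \<Rightarrow> 'a::ab_group_add set \<Rightarrow> 'b::ab_group_add set \<Rightarrow>
   ('s::semigroup_mult, 'a) rbf_ops \<Rightarrow> ('s, 'a, 'b) ext_datum rel"
  where "datum_equiv sR sV lam R V X = {(D, D').
    D \<in> Ext_structs sR sV lam R V X \<and> D' \<in> Ext_structs sR sV lam R V X \<and>
    (\<exists>g h. linear_on sV sR V R g \<and> linear_on sV sV V V h \<and> bij_betw h V V \<and>
      datum_compat R V X D D' g h)}"

definition datum_cohom ::
  "('k::field \<Rightarrow> 'a \<Rightarrow> 'a) \<Rightarrow> ('k \<Rightarrow> 'b \<Rightarrow> 'b) \<Rightarrow> 'k \<Rightarrow> 'a::ab_group_add set \<Rightarrow> 'b::ab_group_add set \<Rightarrow>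
   ('s::semigroup_mult, 'a) rbf_ops \<Rightarrow> ('s, 'a, 'b) ext_datum rel"
  where "datum_cohom sR sV lam R V X = {(D, D').
    D \<in> Ext_structs sR sV lam R V X \<and> D' \<in> Ext_structs sR sV lam R V X \<and>
    (\<exists>g. linear_on sV sR V R g \<and> datum_compat R V X D D' g id)}"


section \<open>The extending structure obtained from an extension\<close>

definition Upsilon1 ::
  "'e set \<Rightarrow> 'e set \<Rightarrow> ('e \<Rightarrow> 'e) \<Rightarrow> ('s, 'e::ab_group_add) rbf_ops \<Rightarrow> ('s, 'e, 'e) ext_datum"
  where "Upsilon1 R V \<rho> Y = \<lparr>
    rtri = (\<lambda>a\<in>R. \<lambda>x\<in>V. mul Y a x - \<rho> (mul Y a x)),
    ltri = (\<lambda>x\<in>V. \<lambda>a\<in>R. mul Y x a - \<rho> (mul Y x a)),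
    rharp = (\<lambda>x\<in>V. \<lambda>a\<in>R. \<rho> (mul Y x a)),
    lharp = (\<lambda>a\<in>R. \<lambda>x\<in>V. \<rho> (mul Y a x)),
    cocyc = (\<lambda>x\<in>V. \<lambda>y\<in>V. \<rho> (mul Y x y)),
    mulV = (\<lambda>x\<in>V. \<lambda>y\<in>V. mul Y x y - \<rho> (mul Y x y)),
    Qmap = (\<lambda>\<omega>. \<lambda>x\<in>V. \<rho> (rb Y \<omega> x)),
    rbV = (\<lambda>\<omega>. \<lambda>x\<in>V. rb Y \<omega> x - \<rho> (rb Y \<omega> x)),
    eta = (\<lambda>x\<in>V. \<rho> (twist Y x)),
    twistV = (\<lambda>x\<in>V. twist Y x - \<rho> (twist Y x))\<rparr>"

end

theory Submission
  imports Defs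
begin

text \<open>The splitting \<open>e = \<rho> e + (e - \<rho> e)\<close> identifies \<open>E\<close> with \<open>R \<times> V\<close>. Under it an extension \<open>Y\<close>
  becomes the unified product of its datum \<open>\<Upsilon>\<^sub>1 Y\<close>, and conversely the unified product of any
  datum can be transported back to \<open>E\<close>, so \<open>\<Upsilon>\<^sub>1\<close> is onto. A linear map \<open>\<psi>\<close> that fixes \<open>R\<close> is
  determined by its components \<open>g = \<rho> \<circ> \<psi>\<close> and \<open>h = \<pi> \<circ> \<psi>\<close> on \<open>V\<close>; it is multiplicative and
  compatible with the operators iff \<open>(g, h)\<close> satisfies the equations relating the two data, it is
  bijective iff \<open>h\<close> is, and it co-stabilizes \<open>V\<close> iff \<open>h = id\<close>. So \<open>\<Upsilon>\<^sub>1\<close> preserves and reflects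
  both relations.\<close>

section \<open>Maps between quotients\<close>

text \<open>Every element of \<open>B\<close> has the form \<open>f x\<close>, so reflexivity,
  symmetry and transitivity of \<open>s\<close> are inherited from \<open>r\<close> through
  \<open>iff\<close>. The two directions of \<open>iff\<close> then make the induced map well
  defined and injective, and surjectivity of \<open>f\<close> makes it onto.\<close>

lemma quotient_bij_of_surj:
  assumes r: "equiv A r" and s: "s \<subseteq> B \<times> B" and f: "f ` A = B"
    and iff: "\<And>x y. x \<in> A \<Longrightarrow> y \<in> A \<Longrightarrow> (x, y) \<in> r \<longleftrightarrow> (f x, f y) \<in> s"
  shows "\<exists>F. bij_betw F (A // r) (B // s) \<and> (\<forall>x\<in>A. F (r `` {x}) = s `` {f x})"
proof -
  have rA: "r \<subseteq> A \<times> A"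
    using r by (simp add: equiv_type)
  have "equiv B s"
  proof (rule equivI)
    show "refl_on B s"
      unfolding refl_on_def using f iff equiv_class_self[OF r] by auto
    show "sym s"
    proof (rule symI)
      fix u v assume uv: "(u, v) \<in> s"
      then obtain x y where "x \<in> A" "y \<in> A" "u = f x" "v = f y"
        using s f by blast
      then show "(v, u) \<in> s"
        using uv iff r by (metis equiv_def symD)
    qed
    show "trans s"
    proof (rule transI)
      fix u v w assume uv: "(u, v) \<in> s" "(v, w) \<in> s"
      then obtain x y z where "x \<in> A" "y \<in> A" "z \<in> A" "u = f x" "v = f y" "w = f z"
        using s f by blast
      then show "(u, w) \<in> s"
        using uv iff r by (metis equiv_def transD)
    qed
  qed (rule s)
  \<comment> \<open>All representatives of the class contribute, so none is chosen; they have
    \<open>r\<close>-related preimages and hence one and the same \<open>s\<close>-class.\<close>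
  define F where "F C = s `` (f ` C)" for C
  have F: "F (r `` {x}) = s `` {f x}" if x: "x \<in> A" for x
  proof -
    have "s `` {f y} = s `` {f x}" if "y \<in> r `` {x}" for y
      using that x rA iff equiv_class_eq[OF \<open>equiv B s\<close>] by blast
    moreover have "x \<in> r `` {x}"
      using equiv_class_self[OF r x] .
    ultimately show ?thesis
      unfolding F_def by blast
  qed
  have "bij_betw F (A // r) (B // s)"
  proof (rule bij_betwI')
    fix C D assume "C \<in> A // r" "D \<in> A // r"
    then obtain x y where xy: "x \<in> A" "y \<in> A" "C = r `` {x}" "D = r `` {y}"
      by (auto elim!: quotientE)
    have "f x \<in> B" "f y \<in> B"
      using xy f by auto
    then have "s `` {f x} = s `` {f y} \<longleftrightarrow> (f x, f y) \<in> s"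
      using eq_equiv_class_iff[OF \<open>equiv B s\<close>] by simp
    also have "\<dots> \<longleftrightarrow> r `` {x} = r `` {y}"
      using iff xy eq_equiv_class_iff[OF r] by simp
    finally show "F C = F D \<longleftrightarrow> C = D"
      using xy F by simp
  next
    fix C assume "C \<in> A // r"
    then show "F C \<in> B // s"
      using F f by (auto elim!: quotientE intro!: quotientI)
  next
    fix D assume "D \<in> B // s"
    then obtain x where "x \<in> A" "D = s `` {f x}"
      using f by (auto elim!: quotientE)
    then show "\<exists>C\<in>A // r. D = F C"
      using F by (metis quotientI)
  qed
  with F show ?thesis by blast
qed

section \<open>Linear maps, closure and transport of structure\<close>

lemma linear_onD:
  assumes "linear_on s1 s2 A B f"
  shows "\<And>x. x \<in> A \<Longrightarrow> f x \<in> B"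
    and "\<And>x y. x \<in> A \<Longrightarrow> y \<in> A \<Longrightarrow> f (x + y) = f x + f y"
    and "\<And>c x. x \<in> A \<Longrightarrow> f (s1 c x) = s2 c (f x)"
  using assms by (auto simp: linear_on_def)

lemma linear_on_0:
  fixes f :: "'a::monoid_add \<Rightarrow> 'b::cancel_comm_monoid_add"
  assumes "linear_on s1 s2 A B f" "0 \<in> A"
  shows "f 0 = 0"
  using linear_onD(2)[OF assms(1,2,2)] by simp

lemma rbf_hom_algebraD:
  assumes "rbf_hom_algebra s lam A X"
  shows "bilinear_on s s s A A A (mul X)"
    and "linear_on s s A A (rb X \<omega>)"
    and "linear_on s s A A (twist X)"
  using assms by (auto simp: rbf_hom_algebra_def)

lemma rbf_hom_algebra_closed:
  assumes "rbf_hom_algebra s lam A X"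
  shows "x \<in> A \<Longrightarrow> y \<in> A \<Longrightarrow> mul X x y \<in> A"
    and "x \<in> A \<Longrightarrow> rb X \<omega> x \<in> A"
    and "x \<in> A \<Longrightarrow> twist X x \<in> A"
    and "x \<in> A \<Longrightarrow> y \<in> A \<Longrightarrow> x + y \<in> A"
    and "x \<in> A \<Longrightarrow> s c x \<in> A"
proof -
  interpret vector_space s
    using assms by (simp add: rbf_hom_algebra_def)
  have "subspace A"
    using assms by (simp add: rbf_hom_algebra_def)
  then show "x \<in> A \<Longrightarrow> y \<in> A \<Longrightarrow> x + y \<in> A" "x \<in> A \<Longrightarrow> s c x \<in> A"
    by (auto simp: subspace_def)
  show "x \<in> A \<Longrightarrow> y \<in> A \<Longrightarrow> mul X x y \<in> A" "x \<in> A \<Longrightarrow> rb X \<omega> x \<in> A" "x \<in> A \<Longrightarrow> twist X x \<in> A"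
    using rbf_hom_algebraD[OF assms] by (auto simp: bilinear_on_def linear_on_def Pi_iff)
qed

lemma rbf_hom_isoD:
  assumes "rbf_hom_iso s1 s2 A B X Y \<phi>"
  shows "\<And>x y. x \<in> A \<Longrightarrow> y \<in> A \<Longrightarrow> \<phi> (x + y) = \<phi> x + \<phi> y"
    and "\<And>c x. x \<in> A \<Longrightarrow> \<phi> (s1 c x) = s2 c (\<phi> x)"
    and "\<And>x y. x \<in> A \<Longrightarrow> y \<in> A \<Longrightarrow> \<phi> (mul X x y) = mul Y (\<phi> x) (\<phi> y)"
    and "\<And>\<omega> x. x \<in> A \<Longrightarrow> \<phi> (rb X \<omega> x) = rb Y \<omega> (\<phi> x)"
    and "\<And>x. x \<in> A \<Longrightarrow> \<phi> (twist X x) = twist Y (\<phi> x)"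
    and "\<phi> ` A = B" and "inj_on \<phi> A"
  using assms by (auto simp: rbf_hom_iso_def rbf_hom_morphism_def linear_on_def bij_betw_def)

text \<open>Each axiom for \<open>Y\<close> at points of \<open>B\<close> is the \<phi>-image of the
  same axiom for \<open>X\<close>. The map \<phi> says nothing about the ambient space outside
  \<open>B\<close>, which is why \<open>s2\<close> is assumed to be a vector space
  structure.\<close>

lemma rbf_hom_algebra_transport:
  assumes alg: "rbf_hom_algebra s1 lam A X" and iso: "rbf_hom_iso s1 s2 A B X Y \<phi>"
    and s2: "vector_space s2"
  shows "rbf_hom_algebra s2 lam B Y"
proof -
  interpret A: vector_space s1
    using alg by (simp add: rbf_hom_algebra_def)
  interpret B: vector_space s2 by (rule s2)
  \<comment> \<open>Reversed, the morphism laws pull \<phi> outwards: a term over images becomes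
    \<phi> of a term over \<open>A\<close>.\<close>
  note \<phi> = rbf_hom_isoD(1-5)[OF iso, symmetric]
  note cl = rbf_hom_algebra_closed[OF alg]
  have B: "B = \<phi> ` A"
    using rbf_hom_isoD(6)[OF iso] by simp
  have A0: "0 \<in> A"
    using alg by (simp add: rbf_hom_algebra_def A.subspace_def)
  have "\<phi> 0 = 0"
    using \<phi>(1)[OF A0 A0] by simp
  then have sub: "B.subspace B"
    unfolding B.subspace_def B using A0 by (auto simp: \<phi> cl intro: rev_image_eqI)
  have "bilinear_on s2 s2 s2 B B B (mul Y)"
    using rbf_hom_algebraD(1)[OF alg] unfolding bilinear_on_def linear_on_def B
    by (auto simp: \<phi> cl)
  moreover have "linear_on s2 s2 B B (rb Y \<omega>)" for \<omega>
    using rbf_hom_algebraD(2)[OF alg, of \<omega>] unfolding linear_on_def B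
    by (auto simp: \<phi> cl)
  moreover have "linear_on s2 s2 B B (twist Y)"
    using rbf_hom_algebraD(3)[OF alg] unfolding linear_on_def B
    by (auto simp: \<phi> cl)
  moreover have "mul Y (twist Y x) (mul Y y z) = mul Y (mul Y x y) (twist Y z)"
    if "x \<in> B" "y \<in> B" "z \<in> B" for x y z
    using that alg unfolding rbf_hom_algebra_def B by (auto simp: \<phi> cl)
  moreover have "mul Y (rb Y \<alpha> x) (rb Y \<beta> y) =
      rb Y (\<alpha> * \<beta>) (mul Y (rb Y \<alpha> x) y + mul Y x (rb Y \<beta> y) + s2 lam (mul Y x y))"
    if "x \<in> B" "y \<in> B" for x y \<alpha> \<beta>
    using that alg unfolding rbf_hom_algebra_def B by (auto simp: \<phi> cl)
  moreover have "rb Y \<omega> (twist Y x) = twist Y (rb Y \<omega> x)" if "x \<in> B" for x \<omega>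
    using that alg unfolding rbf_hom_algebra_def B by (auto simp: \<phi> cl)
  ultimately show ?thesis
    using sub s2 by (simp add: rbf_hom_algebra_def)
qed

section \<open>Equivalence relations on the set of extensions\<close>

lemma rbf_hom_iso_id: "rbf_hom_iso s s A A X X id"
  by (simp add: rbf_hom_iso_def rbf_hom_morphism_def linear_on_def)

lemma rbf_hom_iso_comp:
  assumes "rbf_hom_iso s1 s2 A B X Y \<phi>" "rbf_hom_iso s2 s3 B C Y Z \<psi>"
  shows "rbf_hom_iso s1 s3 A C X Z (\<psi> \<circ> \<phi>)"
  using assms bij_betw_trans[of \<phi> A B \<psi> C]
  by (auto simp: rbf_hom_iso_def rbf_hom_morphism_def linear_on_def Pi_iff)

text \<open>Write the points of \<open>B\<close> as \<phi> x and pull \<phi> outwards, so that the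
  inverse cancels it. The cancellation requires the operations of \<open>X\<close> to stay in
  \<open>A\<close>, hence the hypothesis \<open>alg\<close>.\<close>

lemma rbf_hom_iso_inv_into:
  assumes alg: "rbf_hom_algebra s1 lam A X" and iso: "rbf_hom_iso s1 s2 A B X Y \<phi>"
  shows "rbf_hom_iso s2 s1 B A Y X (inv_into A \<phi>)"
proof -
  note \<phi> = rbf_hom_isoD(1-5)[OF iso, symmetric]
  note cl = rbf_hom_algebra_closed[OF alg]
  have "B = \<phi> ` A" "inj_on \<phi> A"
    using rbf_hom_isoD(6,7)[OF iso] by auto
  then show ?thesis
    unfolding rbf_hom_iso_def rbf_hom_morphism_def linear_on_def
    by (auto simp: \<phi> cl inj_on_imp_bij_betw bij_betw_inv_into)
qed

text \<open>Covers \<open>\<equiv>\<close> and \<open>\<approx>\<close> at once: \<open>P\<close> is the stabilization condition on the isomorphism.\<close>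

lemma Exts_iso_equiv:
  assumes id: "P id"
    and comp: "\<And>\<phi> \<psi>. P \<phi> \<Longrightarrow> P \<psi> \<Longrightarrow> P (\<psi> \<circ> \<phi>)"
    and inv: "\<And>\<phi>. bij \<phi> \<Longrightarrow> P \<phi> \<Longrightarrow> P (inv \<phi>)"
  shows "equiv (Exts s lam R X) {(Y, Z). Y \<in> Exts s lam R X \<and> Z \<in> Exts s lam R X \<and>
    (\<exists>\<psi>. rbf_hom_iso s s UNIV UNIV Y Z \<psi> \<and> P \<psi>)}" (is "equiv _ ?r")
proof (rule equivI)
  show "?r \<subseteq> Exts s lam R X \<times> Exts s lam R X"
    by auto
  show "refl_on (Exts s lam R X) ?r"
    using id rbf_hom_iso_id by (auto simp: refl_on_def)
  show "sym ?r"
  proof (rule symI)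
    fix Y Z assume "(Y, Z) \<in> ?r"
    then obtain \<psi> where YZ: "Y \<in> Exts s lam R X" "Z \<in> Exts s lam R X"
      and \<psi>: "rbf_hom_iso s s UNIV UNIV Y Z \<psi>" "P \<psi>" by auto
    moreover from YZ \<psi> have "rbf_hom_iso s s UNIV UNIV Z Y (inv \<psi>)"
      by (auto simp: Exts_def intro: rbf_hom_iso_inv_into)
    moreover have "P (inv \<psi>)"
      using \<psi> by (auto intro!: inv simp: rbf_hom_iso_def)
    ultimately show "(Z, Y) \<in> ?r" by blast
  qed
  show "trans ?r"
    using comp by (fastforce intro!: transI intro: rbf_hom_iso_comp)
qed

lemma equiv_Exts_equiv: "equiv (Exts s lam R X) (Exts_equiv s lam R X)"
  unfolding Exts_equiv_def
  by (rule Exts_iso_equiv) (auto simp: bij_is_inj inv_f_eq)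

lemma equiv_Exts_cohom:
  fixes \<rho> :: "'e::ab_group_add \<Rightarrow> 'e"
  shows "equiv (Exts s lam R X) (Exts_cohom s lam R X \<rho>)"
  unfolding Exts_cohom_def
proof (rule Exts_iso_equiv)
  fix \<phi> :: "'e \<Rightarrow> 'e"
  assume "bij \<phi>" and "(\<forall>a\<in>R. \<phi> a = a) \<and> ker_proj \<rho> \<circ> \<phi> = ker_proj \<rho>"
  \<comment> \<open>Composing the co-stabilization equation on the right with the inverse of \<phi>
    gives it for the inverse.\<close>
  then show "(\<forall>a\<in>R. inv \<phi> a = a) \<and> ker_proj \<rho> \<circ> inv \<phi> = ker_proj \<rho>"
    by (metis bij_is_inj bij_is_surj comp_assoc comp_id inv_f_f surj_iff)
qed (auto simp: fun_eq_iff)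

section \<open>Linearity, closure and equality of extending data\<close>

text \<open>This lemma and its bilinear analogue cover all fields of \<open>Upsilon1\<close>: each
  field is an operation of the extension followed by \<open>p\<close>, where \<open>p\<close> is
  \<rho> or the projection to \<open>V\<close>, and restricted to \<open>R\<close> or
  \<open>V\<close>.\<close>

lemma linear_on_restrict:
  assumes "vector_space s" "linear_on s s UNIV UNIV f" "linear_on s s UNIV B p"
    and "module.subspace s A"
  shows "linear_on s s A B (\<lambda>x\<in>A. p (f x))"
proof -
  interpret vector_space s by fact
  show ?thesis
    using assms(2-) by (auto simp: linear_on_def subspace_def)
qed

lemma bilinear_on_restrict:
  assumes "vector_space s" "bilinear_on s s s UNIV UNIV UNIV m" "linear_on s s UNIV C p"
    and "module.subspace s A" "module.subspace s B"
  shows "bilinear_on s s s A B C (\<lambda>x\<in>A. \<lambda>y\<in>B. p (m x y))"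
proof -
  interpret vector_space s by fact
  show ?thesis
    using assms(2-) by (auto simp: bilinear_on_def linear_on_def subspace_def)
qed

lemma extending_datum_closed:
  assumes "extending_datum sR sV R V D"
  shows "a \<in> R \<Longrightarrow> x \<in> V \<Longrightarrow> rtri D a x \<in> V"
    and "a \<in> R \<Longrightarrow> x \<in> V \<Longrightarrow> ltri D x a \<in> V"
    and "a \<in> R \<Longrightarrow> x \<in> V \<Longrightarrow> rharp D x a \<in> R"
    and "a \<in> R \<Longrightarrow> x \<in> V \<Longrightarrow> lharp D a x \<in> R"
    and "x \<in> V \<Longrightarrow> y \<in> V \<Longrightarrow> cocyc D x y \<in> R"
    and "x \<in> V \<Longrightarrow> y \<in> V \<Longrightarrow> mulV D x y \<in> V"
    and "x \<in> V \<Longrightarrow> Qmap D \<omega> x \<in> R"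
    and "x \<in> V \<Longrightarrow> rbV D \<omega> x \<in> V"
    and "x \<in> V \<Longrightarrow> eta D x \<in> R"
    and "x \<in> V \<Longrightarrow> twistV D x \<in> V"
proof -
  note dat = assms[unfolded extending_datum_def]
  have "rtri D \<in> R \<rightarrow>\<^sub>E V \<rightarrow>\<^sub>E V" using dat by (elim conjE)
  then show "a \<in> R \<Longrightarrow> x \<in> V \<Longrightarrow> rtri D a x \<in> V" by (meson PiE_mem)
  have "ltri D \<in> V \<rightarrow>\<^sub>E R \<rightarrow>\<^sub>E V" using dat by (elim conjE)
  then show "a \<in> R \<Longrightarrow> x \<in> V \<Longrightarrow> ltri D x a \<in> V" by (meson PiE_mem)
  have "rharp D \<in> V \<rightarrow>\<^sub>E R \<rightarrow>\<^sub>E R" using dat by (elim conjE)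
  then show "a \<in> R \<Longrightarrow> x \<in> V \<Longrightarrow> rharp D x a \<in> R" by (meson PiE_mem)
  have "lharp D \<in> R \<rightarrow>\<^sub>E V \<rightarrow>\<^sub>E R" using dat by (elim conjE)
  then show "a \<in> R \<Longrightarrow> x \<in> V \<Longrightarrow> lharp D a x \<in> R" by (meson PiE_mem)
  have "cocyc D \<in> V \<rightarrow>\<^sub>E V \<rightarrow>\<^sub>E R" using dat by (elim conjE)
  then show "x \<in> V \<Longrightarrow> y \<in> V \<Longrightarrow> cocyc D x y \<in> R" by (meson PiE_mem)
  have "mulV D \<in> V \<rightarrow>\<^sub>E V \<rightarrow>\<^sub>E V" using dat by (elim conjE)
  then show "x \<in> V \<Longrightarrow> y \<in> V \<Longrightarrow> mulV D x y \<in> V" by (meson PiE_mem)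
  have "Qmap D \<omega> \<in> V \<rightarrow>\<^sub>E R" using dat by blast
  then show "x \<in> V \<Longrightarrow> Qmap D \<omega> x \<in> R" by (rule PiE_mem)
  have "rbV D \<omega> \<in> V \<rightarrow>\<^sub>E V" using dat by blast
  then show "x \<in> V \<Longrightarrow> rbV D \<omega> x \<in> V" by (rule PiE_mem)
  have "eta D \<in> V \<rightarrow>\<^sub>E R" using dat by (elim conjE)
  then show "x \<in> V \<Longrightarrow> eta D x \<in> R" by (rule PiE_mem)
  have "twistV D \<in> V \<rightarrow>\<^sub>E V" using dat by (elim conjE)
  then show "x \<in> V \<Longrightarrow> twistV D x \<in> V" by (rule PiE_mem)
qed

lemma PiE_PiE_ext:
  assumes "F \<in> A \<rightarrow>\<^sub>E B \<rightarrow>\<^sub>E C" "G \<in> A \<rightarrow>\<^sub>E B \<rightarrow>\<^sub>E C"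
    and "\<And>x y. x \<in> A \<Longrightarrow> y \<in> B \<Longrightarrow> F x y = G x y"
  shows "F = G"
proof (rule PiE_ext[OF assms(1,2)])
  fix x assume "x \<in> A"
  with assms show "F x = G x"
    by (intro PiE_ext[of "F x" B "\<lambda>_. C"]) (auto simp: PiE_mem)
qed

text \<open>The extensional function spaces fix all values outside \<open>R\<close> and
  \<open>V\<close>, so agreement there gives equality of the records. Surjectivity of
  \<open>Upsilon1\<close> rests on this.\<close>

lemma extending_datum_eqI:
  assumes "extending_datum sR sV R V D" "extending_datum sR sV R V D'"
    and "\<And>a x. a \<in> R \<Longrightarrow> x \<in> V \<Longrightarrow> rtri D a x = rtri D' a x"
    and "\<And>a x. a \<in> R \<Longrightarrow> x \<in> V \<Longrightarrow> ltri D x a = ltri D' x a"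
    and "\<And>a x. a \<in> R \<Longrightarrow> x \<in> V \<Longrightarrow> rharp D x a = rharp D' x a"
    and "\<And>a x. a \<in> R \<Longrightarrow> x \<in> V \<Longrightarrow> lharp D a x = lharp D' a x"
    and "\<And>x y. x \<in> V \<Longrightarrow> y \<in> V \<Longrightarrow> cocyc D x y = cocyc D' x y"
    and "\<And>x y. x \<in> V \<Longrightarrow> y \<in> V \<Longrightarrow> mulV D x y = mulV D' x y"
    and "\<And>\<omega> x. x \<in> V \<Longrightarrow> Qmap D \<omega> x = Qmap D' \<omega> x"
    and "\<And>\<omega> x. x \<in> V \<Longrightarrow> rbV D \<omega> x = rbV D' \<omega> x"
    and "\<And>x. x \<in> V \<Longrightarrow> eta D x = eta D' x"
    and "\<And>x. x \<in> V \<Longrightarrow> twistV D x = twistV D' x"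
  shows "D = (D' :: ('s, 'a::plus, 'b::plus) ext_datum)"
proof (rule ext_datum.equality)
  note dat = assms(1,2)[unfolded extending_datum_def]
  show "rtri D = rtri D'" by (rule PiE_PiE_ext[of _ R V V]) (use dat assms(3-) in auto)
  show "ltri D = ltri D'" by (rule PiE_PiE_ext[of _ V R V]) (use dat assms(3-) in auto)
  show "rharp D = rharp D'" by (rule PiE_PiE_ext[of _ V R R]) (use dat assms(3-) in auto)
  show "lharp D = lharp D'" by (rule PiE_PiE_ext[of _ R V R]) (use dat assms(3-) in auto)
  show "cocyc D = cocyc D'" by (rule PiE_PiE_ext[of _ V V R]) (use dat assms(3-) in auto)
  show "mulV D = mulV D'" by (rule PiE_PiE_ext[of _ V V V]) (use dat assms(3-) in auto)
  show "Qmap D = Qmap D'"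
    by (rule ext, rule PiE_ext[of _ V "\<lambda>_. R"]) (use dat assms(3-) in auto)
  show "rbV D = rbV D'"
    by (rule ext, rule PiE_ext[of _ V "\<lambda>_. V"]) (use dat assms(3-) in auto)
  show "eta D = eta D'"
    by (rule PiE_ext[of _ V "\<lambda>_. R"]) (use dat assms(3-) in auto)
  show "twistV D = twistV D'"
    by (rule PiE_ext[of _ V "\<lambda>_. V"]) (use dat assms(3-) in auto)
qed simp

section \<open>The decomposition of E into R and V\<close>

locale linear_retraction = Vector_Spaces.linear scale scale \<rho>
  for scale :: "'k::field \<Rightarrow> 'e::ab_group_add \<Rightarrow> 'e" and \<rho> :: "'e \<Rightarrow> 'e" +
  fixes R V :: "'e set" and lam :: 'k and X :: "('s::semigroup_mult, 'e) rbf_ops"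
  assumes X: "rbf_hom_algebra scale lam R X"
    and ran: "range \<rho> \<subseteq> R"
    and retr: "a \<in> R \<Longrightarrow> \<rho> a = a"
    and V: "V = {x. \<rho> x = 0}"
begin

abbreviation \<pi> :: "'e \<Rightarrow> 'e"
  where "\<pi> \<equiv> ker_proj \<rho>"

abbreviation scale2 :: "'k \<Rightarrow> 'e \<times> 'e \<Rightarrow> 'e \<times> 'e"
  where "scale2 \<equiv> module_prod.scale scale scale"

text \<open>On \<open>R \<times> V\<close> this is the inverse of the splitting that sends
  \<open>e\<close> to \<open>(\<rho> e, \<pi> e)\<close>.\<close>

abbreviation \<sigma> :: "'e \<times> 'e \<Rightarrow> 'e"
  where "\<sigma> \<equiv> \<lambda>(a, x). a + x"

sublocale prod: vector_space_prod scale scale ..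

lemma rho_in [simp]: "\<rho> e \<in> R"
  using ran by auto

lemma rho_rho [simp]: "\<rho> (\<rho> e) = \<rho> e"
  by (simp add: retr)

lemma rho_V: "x \<in> V \<Longrightarrow> \<rho> x = 0"
  by (simp add: V)

lemma pi_in [simp]: "\<pi> e \<in> V"
  by (simp add: V ker_proj_def diff)

lemma pi_R: "a \<in> R \<Longrightarrow> \<pi> a = 0"
  by (simp add: ker_proj_def retr)

lemma pi_V: "x \<in> V \<Longrightarrow> \<pi> x = x"
  by (simp add: ker_proj_def rho_V)

lemma rho_pi [simp]: "\<rho> (\<pi> e) = 0"
  by (simp add: rho_V)

lemma pi_rho [simp]: "\<pi> (\<rho> e) = 0"
  by (simp add: pi_R)

lemma rho_plus_pi [simp]: "\<rho> e + \<pi> e = e"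
  by (simp add: ker_proj_def)

lemma pi_add: "\<pi> (e + f) = \<pi> e + \<pi> f"
  by (simp add: ker_proj_def add)

lemma pi_scale: "\<pi> (scale c e) = scale c (\<pi> e)"
  by (simp add: ker_proj_def scale vs1.scale_right_diff_distrib)

text \<open>Splits one identity in E into an equation in \<open>R\<close> and an equation in
  \<open>V\<close>; in this way each morphism law yields two clauses of
  \<open>datum_compat\<close>.\<close>

lemma eq_iff_components: "e = f \<longleftrightarrow> \<rho> e = \<rho> f \<and> \<pi> e = \<pi> f"
  by (metis rho_plus_pi)

lemma subspace_R: "vs1.subspace R"
proof -
  have "R = range \<rho>"
    using ran retr by (auto simp: image_iff) metis
  then show ?thesis
    by (simp add: subspace_image)
qed

lemma subspace_V: "vs1.subspace V"
  unfolding V by (rule subspace_kernel)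

lemma linear_on_rho: "linear_on scale scale A R \<rho>"
  by (simp add: linear_on_def add scale)

lemma linear_on_pi: "linear_on scale scale A V \<pi>"
  by (simp add: linear_on_def pi_add pi_scale)

lemma rho_sigma: "p \<in> R \<times> V \<Longrightarrow> \<rho> (\<sigma> p) = fst p"
  by (auto simp: add retr rho_V)

lemma pi_sigma: "p \<in> R \<times> V \<Longrightarrow> \<pi> (\<sigma> p) = snd p"
  by (auto simp: pi_add pi_R pi_V)

lemma linear_on_sigma: "linear_on scale2 scale (R \<times> V) UNIV \<sigma>"
  by (auto simp: linear_on_def prod.scale_prod vs1.scale_right_distrib)

lemma bij_betw_sigma: "bij_betw \<sigma> (R \<times> V) UNIV"
  by (rule bij_betw_byWitness[where f' = "\<lambda>e. (\<rho> e, \<pi> e)"])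
    (auto simp: add retr rho_V pi_add pi_R pi_V)

section \<open>From extensions to extending structures\<close>

lemma Upsilon1_apply:
  shows "a \<in> R \<Longrightarrow> x \<in> V \<Longrightarrow> rtri (Upsilon1 R V \<rho> Y) a x = \<pi> (mul Y a x)"
    and "a \<in> R \<Longrightarrow> x \<in> V \<Longrightarrow> ltri (Upsilon1 R V \<rho> Y) x a = \<pi> (mul Y x a)"
    and "a \<in> R \<Longrightarrow> x \<in> V \<Longrightarrow> rharp (Upsilon1 R V \<rho> Y) x a = \<rho> (mul Y x a)"
    and "a \<in> R \<Longrightarrow> x \<in> V \<Longrightarrow> lharp (Upsilon1 R V \<rho> Y) a x = \<rho> (mul Y a x)"
    and "x \<in> V \<Longrightarrow> y \<in> V \<Longrightarrow> cocyc (Upsilon1 R V \<rho> Y) x y = \<rho> (mul Y x y)"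
    and "x \<in> V \<Longrightarrow> y \<in> V \<Longrightarrow> mulV (Upsilon1 R V \<rho> Y) x y = \<pi> (mul Y x y)"
    and "x \<in> V \<Longrightarrow> Qmap (Upsilon1 R V \<rho> Y) \<omega> x = \<rho> (rb Y \<omega> x)"
    and "x \<in> V \<Longrightarrow> rbV (Upsilon1 R V \<rho> Y) \<omega> x = \<pi> (rb Y \<omega> x)"
    and "x \<in> V \<Longrightarrow> eta (Upsilon1 R V \<rho> Y) x = \<rho> (twist Y x)"
    and "x \<in> V \<Longrightarrow> twistV (Upsilon1 R V \<rho> Y) x = \<pi> (twist Y x)"
  by (simp_all add: Upsilon1_def ker_proj_def)

lemma extending_datum_Upsilon1:
  assumes "rbf_hom_algebra scale lam UNIV Y"
  shows "extending_datum scale scale R V (Upsilon1 R V \<rho> Y)"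
proof -
  note lin = linear_on_restrict[OF vs1.vector_space_axioms _ _ subspace_V]
  note bil = bilinear_on_restrict[OF vs1.vector_space_axioms rbf_hom_algebraD(1)[OF assms]]
  note Y = rbf_hom_algebraD(2,3)[OF assms]
  show ?thesis
    unfolding extending_datum_def Upsilon1_def ext_datum.simps ker_proj_def[symmetric]
    by (intro conjI allI lin bil Y linear_on_rho linear_on_pi subspace_R subspace_V) auto
qed

lemma ExtsD:
  assumes "Y \<in> Exts scale lam R X"
  shows "rbf_hom_algebra scale lam UNIV Y"
    and "mul Y (e + f) w = mul Y e w + mul Y f w" "mul Y w (e + f) = mul Y w e + mul Y w f"
    and "rb Y \<omega> (e + f) = rb Y \<omega> e + rb Y \<omega> f" "twist Y (e + f) = twist Y e + twist Y f"
    and "a \<in> R \<Longrightarrow> b \<in> R \<Longrightarrow> mul Y a b = mul X a b"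
    and "a \<in> R \<Longrightarrow> rb Y \<omega> a = rb X \<omega> a" "a \<in> R \<Longrightarrow> twist Y a = twist X a"
  using assms
  by (auto simp: Exts_def rbf_hom_algebra_def bilinear_on_def linear_on_def)

text \<open>Expand each argument as \<rho> e + \<pi> e. Terms with all arguments in \<open>R\<close>
  stay in \<open>R\<close> and agree with \<open>X\<close>; for the others, the \<rho>- and
  \<pi>-components are the fields of the datum by definition. The sums are the formulas of the
  unified product.\<close>

lemma rbf_hom_iso_Upsilon1:
  assumes Y: "Y \<in> Exts scale lam R X"
  shows "rbf_hom_iso scale scale2 UNIV (R \<times> V) Y (unified_product X (Upsilon1 R V \<rho> Y))
    (\<lambda>e. (\<rho> e, \<pi> e))" (is "rbf_hom_iso _ _ _ _ _ ?U ?\<tau>")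
proof -
  note Yadd = ExtsD(2-5)[OF Y] and YX = ExtsD(6-8)[OF Y, symmetric]
  have closed: "a \<in> R \<Longrightarrow> b \<in> R \<Longrightarrow> mul Y a b \<in> R" "a \<in> R \<Longrightarrow> rb Y \<omega> a \<in> R"
    "a \<in> R \<Longrightarrow> twist Y a \<in> R" for a b \<omega>
    using X rbf_hom_algebra_closed ExtsD(6-8)[OF Y] by metis+
  have "linear_on scale scale2 UNIV (R \<times> V) ?\<tau>"
    by (simp add: linear_on_def add scale pi_add pi_scale prod.scale_prod)
  moreover have "?\<tau> (mul Y e f) = mul ?U (?\<tau> e) (?\<tau> f)" for e f
  proof -
    have "mul Y e f = mul Y (\<rho> e + \<pi> e) (\<rho> f + \<pi> f)"
      by simp
    also have "?\<tau> \<dots> = mul ?U (?\<tau> e) (?\<tau> f)"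
      unfolding Yadd
      by (simp add: unified_product_def Upsilon1_apply YX add pi_add retr pi_R closed)
    finally show ?thesis .
  qed
  moreover have "?\<tau> (rb Y \<omega> e) = rb ?U \<omega> (?\<tau> e)" for \<omega> e
  proof -
    have "rb Y \<omega> e = rb Y \<omega> (\<rho> e + \<pi> e)"
      by simp
    also have "?\<tau> \<dots> = rb ?U \<omega> (?\<tau> e)"
      unfolding Yadd
      by (simp add: unified_product_def Upsilon1_apply YX add pi_add retr pi_R closed)
    finally show ?thesis .
  qed
  moreover have "?\<tau> (twist Y e) = twist ?U (?\<tau> e)" for e
  proof -
    have "twist Y e = twist Y (\<rho> e + \<pi> e)"
      by simp
    also have "?\<tau> \<dots> = twist ?U (?\<tau> e)"
      unfolding Yadd
      by (simp add: unified_product_def Upsilon1_apply YX add pi_add retr pi_R closed)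
    finally show ?thesis .
  qed
  moreover have "bij_betw ?\<tau> UNIV (R \<times> V)"
    by (rule bij_betw_byWitness[where f' = \<sigma>])
      (auto simp: add retr rho_V pi_add pi_R pi_V)
  ultimately show ?thesis
    by (simp add: rbf_hom_iso_def rbf_hom_morphism_def)
qed

text \<open>The axioms on \<open>R \<times> V\<close> need no separate check: they are transported
  from E along the splitting.\<close>

lemma Upsilon1_in_Ext_structs:
  assumes Y: "Y \<in> Exts scale lam R X"
  shows "Upsilon1 R V \<rho> Y \<in> Ext_structs scale scale lam R V X"
  using extending_datum_Upsilon1[OF ExtsD(1)[OF Y]]
    rbf_hom_algebra_transport[OF ExtsD(1)[OF Y] rbf_hom_iso_Upsilon1[OF Y]
      prod.p.vector_space_axioms]
  by (simp add: Ext_structs_def)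

section \<open>Surjectivity of \<open>Upsilon1\<close>\<close>

lemma Upsilon1_surj:
  assumes D: "D \<in> Ext_structs scale scale lam R V X"
  shows "\<exists>Y \<in> Exts scale lam R X. Upsilon1 R V \<rho> Y = D"
proof -
  let ?U = "unified_product X D"
  let ?\<tau> = "\<lambda>e. (\<rho> e, \<pi> e)"
  have dat: "extending_datum scale scale R V D"
    and U: "rbf_hom_algebra scale2 lam (R \<times> V) ?U"
    using D by (auto simp: Ext_structs_def)
  \<comment> \<open>The unified product carried back to E: split the arguments, operate in
    \<open>R \<times> V\<close>, add the two components.\<close>
  define Y where "Y = \<lparr>mul = \<lambda>e f. \<sigma> (mul ?U (?\<tau> e) (?\<tau> f)),
    rb = \<lambda>\<omega> e. \<sigma> (rb ?U \<omega> (?\<tau> e)), twist = \<lambda>e. \<sigma> (twist ?U (?\<tau> e))\<rparr>"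
  \<comment> \<open>This cancellation is what makes \<sigma> compatible with the operations, since
    those of \<open>Y\<close> begin with the splitting.\<close>
  have "?\<tau> (\<sigma> p) = p" if "p \<in> R \<times> V" for p
    using that by (simp add: rho_sigma pi_sigma)
  then have "rbf_hom_iso scale2 scale (R \<times> V) UNIV ?U Y \<sigma>"
    using linear_on_sigma bij_betw_sigma
    by (simp add: rbf_hom_iso_def rbf_hom_morphism_def Y_def del: split_paired_All)
  then have algY: "rbf_hom_algebra scale lam UNIV Y"
    using rbf_hom_algebra_transport[OF U] vs1.vector_space_axioms by blast
  have zero: "0 \<in> R" "0 \<in> V"
    using subspace_R subspace_V by (auto simp: vs1.subspace_def)
  have bil0: "f 0 y = 0" "f x 0 = 0"
    if "bilinear_on scale scale scale A B C f" "0 \<in> A" "0 \<in> B" "x \<in> A" "y \<in> B"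
    for A B C :: "'e set" and f x y
    using that linear_on_0 unfolding bilinear_on_def by metis+
  \<comment> \<open>Elements of \<open>R\<close> split as (a, 0) and elements of \<open>V\<close> as
    (0, x). With these vanishing rules only the intended terms of the unified product survive: those
    of \<open>X\<close> on \<open>R\<close>, and single fields of \<open>D\<close>
    otherwise.\<close>
  have dat0: "rtri D 0 x = 0" "rtri D a 0 = 0" "ltri D 0 a = 0" "ltri D x 0 = 0"
    "rharp D 0 a = 0" "rharp D x 0 = 0" "lharp D 0 x = 0" "lharp D a 0 = 0"
    "cocyc D 0 x = 0" "cocyc D x 0 = 0" "mulV D 0 x = 0" "mulV D x 0 = 0"
    "Qmap D \<omega> 0 = 0" "rbV D \<omega> 0 = 0" "eta D 0 = 0" "twistV D 0 = 0"
    if "a \<in> R" "x \<in> V" for a x \<omega>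
    using that zero dat unfolding extending_datum_def by (blast intro: bil0 linear_on_0)+
  have X0: "mul X 0 a = 0" "mul X a 0 = 0" "rb X \<omega> 0 = 0" "twist X 0 = 0"
    if "a \<in> R" for a \<omega>
    using that zero rbf_hom_algebraD[OF X] by (blast intro: bil0 linear_on_0)+
  have "Y \<in> Exts scale lam R X"
    using algY zero
    by (auto simp: Exts_def Y_def unified_product_def retr pi_R dat0)
  moreover have "Upsilon1 R V \<rho> Y = D"
  proof -
    \<comment> \<open>In each sum the first term lies in \<open>R\<close> and the second in
      \<open>V\<close>, so \<rho> and \<pi> recover the fields of \<open>D\<close>.\<close>
    have "a \<in> R \<Longrightarrow> x \<in> V \<Longrightarrow> mul Y a x = lharp D a x + rtri D a x"
      "a \<in> R \<Longrightarrow> x \<in> V \<Longrightarrow> mul Y x a = rharp D x a + ltri D x a"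
      "x \<in> V \<Longrightarrow> y \<in> V \<Longrightarrow> mul Y x y = cocyc D x y + mulV D x y"
      "x \<in> V \<Longrightarrow> rb Y \<omega> x = Qmap D \<omega> x + rbV D \<omega> x"
      "x \<in> V \<Longrightarrow> twist Y x = eta D x + twistV D x" for a x y \<omega>
      using zero by (simp_all add: Y_def unified_product_def retr pi_R pi_V rho_V dat0 X0)
    then show ?thesis
      by (intro extending_datum_eqI[OF extending_datum_Upsilon1[OF algY] dat])
        (simp_all add: Upsilon1_apply extending_datum_closed[OF dat] add pi_add
          retr rho_V pi_R pi_V)
  qed
  ultimately show ?thesis by blast
qed

section \<open>Morphisms fixing R as pairs (g, h)\<close>

text \<open>By additivity the morphism laws need testing only on arguments from \<open>R\<close> and
  \<open>V\<close>. Arguments all in \<open>R\<close> give nothing new, as \<open>Y\<close> and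
  \<open>Z\<close> agree there and \<psi> fixes \<open>R\<close>. Each of the five remaining cases
  splits into its two components.\<close>

lemma rbf_hom_morphism_iff_compat:
  assumes Y: "Y \<in> Exts scale lam R X" and Z: "Z \<in> Exts scale lam R X"
    and \<psi>: "linear_on scale scale UNIV UNIV \<psi>" and fixR: "\<And>a. a \<in> R \<Longrightarrow> \<psi> a = a"
  shows "rbf_hom_morphism scale scale UNIV UNIV Y Z \<psi> \<longleftrightarrow>
    datum_compat R V X (Upsilon1 R V \<rho> Y) (Upsilon1 R V \<rho> Z) (\<lambda>x. \<rho> (\<psi> x)) (\<lambda>x. \<pi> (\<psi> x))"
    (is "_ = ?compat")
proof -
  note Yadd = ExtsD(2-5)[OF Y] and YX = ExtsD(6-8)[OF Y]
  note Zadd = ExtsD(2-5)[OF Z] and ZX = ExtsD(6-8)[OF Z]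
  note \<psi>add = linear_onD(2)[OF \<psi>, simplified]
  have closed: "a \<in> R \<Longrightarrow> b \<in> R \<Longrightarrow> mul X a b \<in> R" "a \<in> R \<Longrightarrow> rb X \<omega> a \<in> R"
    "a \<in> R \<Longrightarrow> twist X a \<in> R" for a b \<omega>
    using X rbf_hom_algebra_closed by metis+
  \<comment> \<open>The summand \<rho> e appears because \<psi> fixes \<open>R\<close>; it is the
    source of the terms \<open>lharp\<close>, \<open>rharp\<close>, \<open>cocyc\<close>,
    \<open>Qmap\<close> and \<open>eta\<close> on the left of the compatibility equations. This
    equation and \<open>mul_split\<close> match their own right-hand sides, so they are applied at
    chosen arguments.\<close>
  have rho_psi: "\<rho> (\<psi> e) = \<rho> e + \<rho> (\<psi> (\<pi> e))" and pi_psi: "\<pi> (\<psi> (\<pi> e)) = \<pi> (\<psi> e)" for e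
    using \<psi>add[of "\<rho> e" "\<pi> e"] by (simp_all add: fixR add pi_add)
  have mul_split: "mul Z w e = mul Z w (\<rho> e) + mul Z w (\<pi> e)"
    "mul Z e w = mul Z (\<rho> e) w + mul Z (\<pi> e) w"
    "rb Z \<omega> e = rb Z \<omega> (\<rho> e) + rb Z \<omega> (\<pi> e)"
    "twist Z e = twist Z (\<rho> e) + twist Z (\<pi> e)" for w e \<omega>
    by (simp_all flip: Zadd)
  have aV: "\<psi> (mul Y a x) = mul Z a (\<psi> x) \<longleftrightarrow>
      \<pi> (\<psi> (\<pi> (mul Y a x))) = \<pi> (mul Z a (\<pi> (\<psi> x))) \<and>
      \<rho> (mul Y a x) + \<rho> (\<psi> (\<pi> (mul Y a x))) = mul X a (\<rho> (\<psi> x)) + \<rho> (mul Z a (\<pi> (\<psi> x)))"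
    if "a \<in> R" for a x
    unfolding eq_iff_components[of "\<psi> _"] mul_split(1)[of a "\<psi> x"] pi_psi rho_psi[of "mul Y a x"]
    using that by (auto simp: add pi_add ZX closed pi_R retr)
  have Va: "\<psi> (mul Y x a) = mul Z (\<psi> x) a \<longleftrightarrow>
      \<pi> (\<psi> (\<pi> (mul Y x a))) = \<pi> (mul Z (\<pi> (\<psi> x)) a) \<and>
      \<rho> (mul Y x a) + \<rho> (\<psi> (\<pi> (mul Y x a))) = mul X (\<rho> (\<psi> x)) a + \<rho> (mul Z (\<pi> (\<psi> x)) a)"
    if "a \<in> R" for a x
    unfolding eq_iff_components[of "\<psi> _"] mul_split(2)[of "\<psi> x"] pi_psi rho_psi[of "mul Y x a"]
    using that by (auto simp: add pi_add ZX closed pi_R retr)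
  have VV: "\<psi> (mul Y x y) = mul Z (\<psi> x) (\<psi> y) \<longleftrightarrow>
      \<rho> (mul Y x y) + \<rho> (\<psi> (\<pi> (mul Y x y))) =
        mul X (\<rho> (\<psi> x)) (\<rho> (\<psi> y)) + \<rho> (mul Z (\<rho> (\<psi> x)) (\<pi> (\<psi> y))) +
        \<rho> (mul Z (\<pi> (\<psi> x)) (\<rho> (\<psi> y))) + \<rho> (mul Z (\<pi> (\<psi> x)) (\<pi> (\<psi> y))) \<and>
      \<pi> (\<psi> (\<pi> (mul Y x y))) = \<pi> (mul Z (\<rho> (\<psi> x)) (\<pi> (\<psi> y))) +
        \<pi> (mul Z (\<pi> (\<psi> x)) (\<rho> (\<psi> y))) + \<pi> (mul Z (\<pi> (\<psi> x)) (\<pi> (\<psi> y)))" for x y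
    unfolding eq_iff_components[of "\<psi> _"] mul_split(1)[of _ "\<psi> y"] mul_split(2)[of "\<psi> x"]
      pi_psi rho_psi[of "mul Y x y"]
    by (auto simp: add pi_add ZX closed pi_R retr add.assoc add.left_commute)
  have rbV: "\<psi> (rb Y \<omega> x) = rb Z \<omega> (\<psi> x) \<longleftrightarrow>
      \<pi> (\<psi> (\<pi> (rb Y \<omega> x))) = \<pi> (rb Z \<omega> (\<pi> (\<psi> x))) \<and>
      \<rho> (rb Y \<omega> x) + \<rho> (\<psi> (\<pi> (rb Y \<omega> x))) = rb X \<omega> (\<rho> (\<psi> x)) + \<rho> (rb Z \<omega> (\<pi> (\<psi> x)))"
    for \<omega> x
    unfolding eq_iff_components[of "\<psi> _"] mul_split(3)[of _ "\<psi> x"] pi_psi rho_psi[of "rb Y \<omega> x"]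
    by (auto simp: add pi_add ZX closed pi_R retr)
  have twV: "\<psi> (twist Y x) = twist Z (\<psi> x) \<longleftrightarrow>
      \<pi> (\<psi> (\<pi> (twist Y x))) = \<pi> (twist Z (\<pi> (\<psi> x))) \<and>
      \<rho> (twist Y x) + \<rho> (\<psi> (\<pi> (twist Y x))) = twist X (\<rho> (\<psi> x)) + \<rho> (twist Z (\<pi> (\<psi> x)))"
    for x
    unfolding eq_iff_components[of "\<psi> _"] mul_split(4)[of "\<psi> x"] pi_psi rho_psi[of "twist Y x"]
    by (auto simp: add pi_add ZX closed pi_R retr)
  \<comment> \<open>The ten clauses of \<open>datum_compat\<close> are paired: each of the five
    identities on the right accounts for one equation in \<open>V\<close> and one in
    \<open>R\<close>.\<close>
  have "?compat \<longleftrightarrow>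
    (\<forall>a\<in>R. \<forall>x\<in>V. \<psi> (mul Y a x) = mul Z a (\<psi> x)) \<and>
    (\<forall>a\<in>R. \<forall>x\<in>V. \<psi> (mul Y x a) = mul Z (\<psi> x) a) \<and>
    (\<forall>x\<in>V. \<forall>y\<in>V. \<psi> (mul Y x y) = mul Z (\<psi> x) (\<psi> y)) \<and>
    (\<forall>\<omega>. \<forall>x\<in>V. \<psi> (rb Y \<omega> x) = rb Z \<omega> (\<psi> x)) \<and>
    (\<forall>x\<in>V. \<psi> (twist Y x) = twist Z (\<psi> x))" (is "_ \<longleftrightarrow> ?C")
    unfolding datum_compat_def VV rbV twV
    by (simp add: Upsilon1_apply aV Va cong: ball_cong) blast
  also have "?C \<longleftrightarrow> rbf_hom_morphism scale scale UNIV UNIV Y Z \<psi>"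
  proof
    assume C: ?C
    have "\<psi> (mul Y e f) = mul Z (\<psi> e) (\<psi> f)" for e f
    proof -
      have "\<psi> (mul Y (\<rho> e + \<pi> e) (\<rho> f + \<pi> f)) = mul Z (\<psi> (\<rho> e + \<pi> e)) (\<psi> (\<rho> f + \<pi> f))"
        \<comment> \<open>Of the four products after expansion, three are covered by
          \<open>C\<close>; the one with both factors in \<open>R\<close> holds because
          \<open>Y\<close> and \<open>Z\<close> both restrict to \<open>X\<close>.\<close>
        unfolding Yadd \<psi>add Zadd using C by (simp add: fixR YX ZX closed)
      then show ?thesis by simp
    qed
    moreover have "\<psi> (rb Y \<omega> e) = rb Z \<omega> (\<psi> e)" for \<omega> e
    proof -
      have "\<psi> (rb Y \<omega> (\<rho> e + \<pi> e)) = rb Z \<omega> (\<psi> (\<rho> e + \<pi> e))"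
        unfolding Yadd \<psi>add Zadd using C by (simp add: fixR YX ZX closed)
      then show ?thesis by simp
    qed
    moreover have "\<psi> (twist Y e) = twist Z (\<psi> e)" for e
    proof -
      have "\<psi> (twist Y (\<rho> e + \<pi> e)) = twist Z (\<psi> (\<rho> e + \<pi> e))"
        unfolding Yadd \<psi>add Zadd using C by (simp add: fixR YX ZX closed)
      then show ?thesis by simp
    qed
    ultimately show "rbf_hom_morphism scale scale UNIV UNIV Y Z \<psi>"
      using \<psi> by (simp add: rbf_hom_morphism_def)
  qed (simp add: rbf_hom_morphism_def fixR)
  finally show ?thesis by simp
qed

text \<open>With respect to E = R + V the map \<psi> is block triangular, with the identity on
  \<open>R\<close> and h = \<pi> \<psi> on \<open>V\<close> as diagonal blocks.\<close>

lemma bij_iff_bij_betw_V: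
  assumes \<psi>: "linear_on scale scale UNIV UNIV \<psi>" and fixR: "\<And>a. a \<in> R \<Longrightarrow> \<psi> a = a"
  shows "bij \<psi> \<longleftrightarrow> bij_betw (\<lambda>x. \<pi> (\<psi> x)) V V"
proof -
  note \<psi>add = linear_onD(2)[OF \<psi>, simplified]
  have split: "\<psi> e = \<rho> e + \<psi> (\<pi> e)" and pi_psi: "\<pi> (\<psi> (\<pi> e)) = \<pi> (\<psi> e)" for e
    using \<psi>add[of "\<rho> e" "\<pi> e"] by (simp_all add: fixR pi_add)
  show ?thesis
  proof
    assume bij: "bij \<psi>"
    show "bij_betw (\<lambda>x. \<pi> (\<psi> x)) V V"
    proof (rule bij_betwI')
      fix x y assume xy: "x \<in> V" "y \<in> V"
      have "x = y" if eq: "\<pi> (\<psi> x) = \<pi> (\<psi> y)"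
      proof -
        \<comment> \<open>If h x = h y, then \<psi> x and \<psi> y differ only in \<open>R\<close>.
          Adding the \<rho>-part of each to the other argument equalizes the images, because \<psi>
          fixes \<open>R\<close>.\<close>
        have "\<psi> (\<rho> (\<psi> y) + x) = \<rho> (\<psi> y) + (\<rho> (\<psi> x) + \<pi> (\<psi> x))"
          by (simp add: \<psi>add fixR)
        also have "\<dots> = \<rho> (\<psi> x) + (\<rho> (\<psi> y) + \<pi> (\<psi> y))"
          by (simp only: eq add.left_commute)
        also have "\<dots> = \<psi> (\<rho> (\<psi> x) + y)"
          by (simp add: \<psi>add fixR)
        finally have "\<rho> (\<psi> y) + x = \<rho> (\<psi> x) + y"
          using bij by (simp add: bij_is_inj inj_eq)
        then have "\<pi> (\<rho> (\<psi> y) + x) = \<pi> (\<rho> (\<psi> x) + y)"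
          by simp
        then show "x = y"
          using xy by (simp add: pi_add pi_V)
      qed
      then show "\<pi> (\<psi> x) = \<pi> (\<psi> y) \<longleftrightarrow> x = y" by auto
    next
      fix y assume y: "y \<in> V"
      obtain e where "\<psi> e = y"
        using surjD[OF bij_is_surj[OF bij], of y] by auto
      then have "\<pi> (\<psi> (\<pi> e)) = y"
        using y by (simp add: pi_psi pi_V)
      then show "\<exists>x\<in>V. y = \<pi> (\<psi> x)"
        by (intro bexI[of _ "\<pi> e"]) simp_all
    qed simp
  next
    assume bij: "bij_betw (\<lambda>x. \<pi> (\<psi> x)) V V"
    show "bij \<psi>"
    proof (rule bijI)
      show "inj \<psi>"
      proof (rule injI)
        fix e f assume eq: "\<psi> e = \<psi> f"
        then have "\<pi> (\<psi> (\<pi> e)) = \<pi> (\<psi> (\<pi> f))"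
          by (simp add: pi_psi)
        then have "\<pi> e = \<pi> f"
          by (rule inj_onD[OF bij_betw_imp_inj_on[OF bij] _ pi_in pi_in])
        moreover from this have "\<rho> e = \<rho> f"
          using eq split[of e] split[of f] by simp
        ultimately show "e = f"
          using eq_iff_components by blast
      qed
      show "surj \<psi>"
        unfolding surj_def
      proof
        fix e
        have "\<pi> e \<in> (\<lambda>x. \<pi> (\<psi> x)) ` V"
          using bij by (simp add: bij_betw_def)
        then obtain x where x: "\<pi> (\<psi> x) = \<pi> e"
          by (metis imageE)
        \<comment> \<open>The point x gives the right component in \<open>V\<close>; the summand
          from \<open>R\<close> corrects the component in \<open>R\<close>.\<close>
        have "\<psi> (\<rho> e - \<rho> (\<psi> x) + x) = \<rho> e - \<rho> (\<psi> x) + \<psi> x"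
          by (simp add: \<psi>add fixR vs1.subspace_diff[OF subspace_R])
        also have "\<dots> = \<rho> e + \<pi> (\<psi> x)"
          by (simp add: ker_proj_def)
        finally show "\<exists>f. e = \<psi> f"
          by (intro exI[of _ "\<rho> e - \<rho> (\<psi> x) + x"]) (simp add: x)
      qed
    qed
  qed
qed

text \<open>The maps g and h are evaluated only on \<open>V\<close>: closure of \<open>D\<close>
  puts inner arguments such as \<open>rtri D a x\<close> there. So g and h matter only through their
  restrictions to \<open>V\<close>.\<close>

lemma datum_compat_cong:
  assumes "extending_datum scale scale R V D"
    and "\<And>x. x \<in> V \<Longrightarrow> g x = g' x" "\<And>x. x \<in> V \<Longrightarrow> h x = h' x"
  shows "datum_compat R V X D D' g h \<longleftrightarrow> datum_compat R V X D D' g' h'"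
  unfolding datum_compat_def
  by (intro arg_cong2[where f = "(\<and>)"] all_cong ball_cong refl)
    (simp_all add: assms(2,3) extending_datum_closed[OF assms(1)])

text \<open>\<open>P\<close> is trivial for \<open>\<equiv>\<close> and says that \<open>h\<close> is the identity on \<open>V\<close> for \<open>\<approx>\<close>.\<close>

lemma ex_iso_iff_ex_compat:
  assumes Y: "Y \<in> Exts scale lam R X" and Z: "Z \<in> Exts scale lam R X"
    and P: "\<And>h h'. (\<And>x. x \<in> V \<Longrightarrow> h x = h' x) \<Longrightarrow> P h = P h'"
  shows "(\<exists>\<psi>. rbf_hom_iso scale scale UNIV UNIV Y Z \<psi> \<and> (\<forall>a\<in>R. \<psi> a = a) \<and> P (\<lambda>x. \<pi> (\<psi> x)))
    \<longleftrightarrow> (\<exists>g h. linear_on scale scale V R g \<and> linear_on scale scale V V h \<and> bij_betw h V V \<and>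
      datum_compat R V X (Upsilon1 R V \<rho> Y) (Upsilon1 R V \<rho> Z) g h \<and> P h)"
    (is "?lhs \<longleftrightarrow> ?rhs")
proof
  assume ?lhs
  then obtain \<psi> where iso: "rbf_hom_iso scale scale UNIV UNIV Y Z \<psi>"
    and fixR: "\<And>a. a \<in> R \<Longrightarrow> \<psi> a = a" and P\<psi>: "P (\<lambda>x. \<pi> (\<psi> x))"
    by auto
  have mor: "rbf_hom_morphism scale scale UNIV UNIV Y Z \<psi>" and "bij \<psi>"
    using iso by (auto simp: rbf_hom_iso_def)
  then have \<psi>: "linear_on scale scale UNIV UNIV \<psi>"
    by (simp add: rbf_hom_morphism_def)
  then have "linear_on scale scale V R (\<lambda>x. \<rho> (\<psi> x))" "linear_on scale scale V V (\<lambda>x. \<pi> (\<psi> x))"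
    by (simp_all add: linear_on_def add scale pi_add pi_scale)
  then show ?rhs
    using rbf_hom_morphism_iff_compat[OF Y Z \<psi> fixR] bij_iff_bij_betw_V[OF \<psi> fixR] mor \<open>bij \<psi>\<close> P\<psi>
    by blast
next
  assume ?rhs
  then obtain g h where g: "linear_on scale scale V R g" and h: "linear_on scale scale V V h"
    and bij: "bij_betw h V V" and P: "P h"
    and compat: "datum_compat R V X (Upsilon1 R V \<rho> Y) (Upsilon1 R V \<rho> Z) g h"
    by blast
  \<comment> \<open>The block triangular map with prescribed components: a + x goes to a + g x + h
    x.\<close>
  define \<psi> where "\<psi> e = \<rho> e + g (\<pi> e) + h (\<pi> e)" for e
  note gD = linear_onD[OF g] and hD = linear_onD[OF h]
  have "g 0 = 0" "h 0 = 0"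
    using linear_on_0 g h subspace_V vs1.subspace_0 by blast+
  then have fixR: "\<psi> a = a" if "a \<in> R" for a
    using that by (simp add: \<psi>_def retr pi_R)
  have \<psi>: "linear_on scale scale UNIV UNIV \<psi>"
    by (simp add: linear_on_def \<psi>_def add scale pi_add pi_scale gD hD algebra_simps
      vs1.scale_right_distrib)
  have gh: "\<rho> (\<psi> x) = g x" "\<pi> (\<psi> x) = h x" if "x \<in> V" for x
    using that by (simp_all add: \<psi>_def add pi_add rho_V pi_V retr pi_R gD hD)
  have "datum_compat R V X (Upsilon1 R V \<rho> Y) (Upsilon1 R V \<rho> Z) (\<lambda>x. \<rho> (\<psi> x)) (\<lambda>x. \<pi> (\<psi> x))"
    by (rule iffD2[OF datum_compat_cong compat])
      (simp_all add: gh extending_datum_Upsilon1[OF ExtsD(1)[OF Y]])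
  then have "rbf_hom_morphism scale scale UNIV UNIV Y Z \<psi>"
    using rbf_hom_morphism_iff_compat[OF Y Z \<psi> fixR] by blast
  moreover have "bij_betw (\<lambda>x. \<pi> (\<psi> x)) V V"
    by (rule iffD2[OF bij_betw_cong bij]) (rule gh(2))
  then have "bij \<psi>"
    using bij_iff_bij_betw_V[OF \<psi> fixR] by blast
  moreover have "P (\<lambda>x. \<pi> (\<psi> x))"
    by (rule iffD2[OF assms(3) P]) (rule gh(2))
  ultimately show ?lhs
    using fixR by (auto simp: rbf_hom_iso_def)
qed

section \<open>The bijections on classes\<close>

lemma Exts_equiv_iff:
  assumes "Y \<in> Exts scale lam R X" "Z \<in> Exts scale lam R X"
  shows "(Y, Z) \<in> Exts_equiv scale lam R X \<longleftrightarrow>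
    (Upsilon1 R V \<rho> Y, Upsilon1 R V \<rho> Z) \<in> datum_equiv scale scale lam R V X"
  using ex_iso_iff_ex_compat[OF assms, of "\<lambda>_. True"] assms
  by (simp add: Exts_equiv_def datum_equiv_def Upsilon1_in_Ext_structs)

lemma Exts_cohom_iff:
  assumes Y: "Y \<in> Exts scale lam R X" and Z: "Z \<in> Exts scale lam R X"
  shows "(Y, Z) \<in> Exts_cohom scale lam R X \<rho> \<longleftrightarrow>
    (Upsilon1 R V \<rho> Y, Upsilon1 R V \<rho> Z) \<in> datum_cohom scale scale lam R V X"
proof -
  let ?P = "\<lambda>h. \<forall>x\<in>V. h x = x"
  \<comment> \<open>Co-stabilization can be tested on \<open>V\<close>: the \<rho>-part of an
    argument is fixed by \<psi> and then killed by \<pi>.\<close>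
  have "\<pi> \<circ> \<psi> = \<pi> \<longleftrightarrow> ?P (\<lambda>x. \<pi> (\<psi> x))"
    if iso: "rbf_hom_iso scale scale UNIV UNIV Y Z \<psi>" and fixR: "\<forall>a\<in>R. \<psi> a = a" for \<psi>
  proof
    assume P: "?P (\<lambda>x. \<pi> (\<psi> x))"
    have "\<pi> (\<psi> e) = \<pi> e" for e
      using rbf_hom_isoD(1)[OF iso, of "\<rho> e" "\<pi> e"] fixR P by (simp add: pi_add)
    then show "\<pi> \<circ> \<psi> = \<pi>" by auto
  qed (auto simp: fun_eq_iff pi_V)
  then have "(\<exists>\<psi>. rbf_hom_iso scale scale UNIV UNIV Y Z \<psi> \<and> (\<forall>a\<in>R. \<psi> a = a) \<and> \<pi> \<circ> \<psi> = \<pi>)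
    \<longleftrightarrow> (\<exists>\<psi>. rbf_hom_iso scale scale UNIV UNIV Y Z \<psi> \<and> (\<forall>a\<in>R. \<psi> a = a) \<and> ?P (\<lambda>x. \<pi> (\<psi> x)))"
    by blast
  also have "\<dots> \<longleftrightarrow> (\<exists>g h. linear_on scale scale V R g \<and> linear_on scale scale V V h \<and>
      bij_betw h V V \<and>
      datum_compat R V X (Upsilon1 R V \<rho> Y) (Upsilon1 R V \<rho> Z) g h \<and> ?P h)"
    by (rule ex_iso_iff_ex_compat[OF Y Z]) auto
  \<comment> \<open>The map h is known to be the identity only on \<open>V\<close>, whereas
    \<open>datum_cohom\<close> uses \<open>id\<close> itself; \<open>datum_compat_cong\<close>
    exchanges the two.\<close>
  also have "\<dots> \<longleftrightarrow> (\<exists>g. linear_on scale scale V R g \<and>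
      datum_compat R V X (Upsilon1 R V \<rho> Y) (Upsilon1 R V \<rho> Z) g id)" (is "?l \<longleftrightarrow> ?r")
  proof
    assume ?l
    then show ?r
      using datum_compat_cong[OF extending_datum_Upsilon1[OF ExtsD(1)[OF Y]]]
      by (metis id_apply)
  next
    assume ?r
    moreover have "linear_on scale scale V V id"
      by (simp add: linear_on_def)
    ultimately show ?l
      using bij_betw_id by (metis id_apply)
  qed
  finally show ?thesis
    using Y Z by (simp add: Exts_cohom_def datum_cohom_def Upsilon1_in_Ext_structs)
qed

lemma image_Upsilon1:
  "Upsilon1 R V \<rho> ` Exts scale lam R X = Ext_structs scale scale lam R V X"
  using Upsilon1_in_Ext_structs Upsilon1_surj by blast

end

theorem theorem3p11:
  fixes scale :: "'k::field \<Rightarrow> 'e::ab_group_add \<Rightarrow> 'e"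
    and lam :: 'k
    and R V :: "'e set"
    and X :: "('s::semigroup_mult, 'e) rbf_ops"
    and \<rho> :: "'e \<Rightarrow> 'e"
  assumes E: "vector_space scale"
    and sub: "module.subspace scale R"
    and alg: "rbf_hom_algebra scale lam R X"
    and lin: "Vector_Spaces.linear scale scale \<rho>"
    and ran: "range \<rho> \<subseteq> R"
    and retr: "\<And>a. a \<in> R \<Longrightarrow> \<rho> a = a"
    and V: "V = {x. \<rho> x = 0}"
  shows "Upsilon1 R V \<rho> \<in> Exts scale lam R X \<rightarrow> Ext_structs scale scale lam R V X \<and>
    (\<exists>\<Upsilon>. bij_betw \<Upsilon>
        (Exts scale lam R X // Exts_equiv scale lam R X)
        (Ext_structs scale scale lam R V X // datum_equiv scale scale lam R V X) \<and>
      (\<forall>Y \<in> Exts scale lam R X. \<Upsilon> (Exts_equiv scale lam R X `` {Y}) =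
        datum_equiv scale scale lam R V X `` {Upsilon1 R V \<rho> Y})) \<and>
    (\<exists>\<Upsilon>'. bij_betw \<Upsilon>'
        (Exts scale lam R X // Exts_cohom scale lam R X \<rho>)
        (Ext_structs scale scale lam R V X // datum_cohom scale scale lam R V X) \<and>
      (\<forall>Y \<in> Exts scale lam R X. \<Upsilon>' (Exts_cohom scale lam R X \<rho> `` {Y}) =
        datum_cohom scale scale lam R V X `` {Upsilon1 R V \<rho> Y}))"
proof -
  interpret linear_retraction scale \<rho> R V lam X
    using lin ran retr V alg
    by (auto simp: linear_retraction_def linear_retraction_axioms_def)
  show ?thesis
  proof (intro conjI)
    show "Upsilon1 R V \<rho> \<in> Exts scale lam R X \<rightarrow> Ext_structs scale scale lam R V X"
      using Upsilon1_in_Ext_structs by blast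
  \<comment> \<open>Both bijections come from the same surjection \<open>Upsilon1\<close>, which
    preserves and reflects each of the two relations.\<close>
  qed (rule quotient_bij_of_surj;
      auto simp: equiv_Exts_equiv equiv_Exts_cohom image_Upsilon1 Exts_equiv_iff Exts_cohom_iff
        datum_equiv_def datum_cohom_def)+
qed

end
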